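(* Let $P$ be a quasi-graded poset with $\hat0$ and $\hat1$, $\hat0<\hat1$. Then the $\mathbf{ab}$-index of the Cartesian product of $P$ with the Boolean algebra $B_1$ satisfies $$\Psi(P\times B_1)=\mathbf b\cdot\Psi(P)+\Psi(P)\cdot\mathbf a+\sum_{x\in P,\ \hat0<x<\hat1}\Psi([\hat0,x])\cdot\mathbf a\mathbf b\cdot\Psi([x,\hat1]),$$ and $$\Psi(P\times B_1)=\mathrm{Pyr}(\Psi(P)).$$
   Context: A quasi-graded poset $(P,\rho,\bar\zeta)$ consists of a finite poset $P$, a function $\rho:P\to\mathbb N$ with $x<y\Rightarrow\rho(x)<\rho(y)$, and a complex-valued function $\bar\zeta$ in the incidence algebra of $P$ with $\bar\zeta(x,x)=1$ for all $x$. Write $\rho(x,y)=\rho(y)-\rho(x)$. Intervals $[x,y]$ are quasi-graded posets by restricting $\rho$ (shifted by $\rho(x)$) and $\bar\zeta$. If $P$ has minimal element $\hat0$ and maximal element $\hat1$ with $\hat0<\hat1$, its $\mathbf{ab}$-index is the polynomial in non-commuting variables $\mathbf a,\mathbf b$ $$\Psi(P)=\sum_{c}\bar\zeta(x_0,x_1)\cdots\bar\zeta(x_{k-1},x_k)\cdot(\mathbf a-\mathbf b)^{\rho(x_0,x_1)-1}\,\mathbf b\,(\mathbf a-\mathbf b)^{\rho(x_1,x_2)-1}\,\mathbf b\cdots\mathbf b\,(\mathbf a-\mathbf b)^{\rho(x_{k-1},x_k)-1},$$ the sum over all chains $c=\{\hat0=x_0<x_1<\cdots<x_k=\hat1\}$,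 $k\ge1$. The Cartesian product of quasi-graded posets $(P,\rho_P,\bar\zeta_P)$ and $(Q,\rho_Q,\bar\zeta_Q)$ is $P\times Q$ with the componentwise order, $\rho((x,y))=\rho_P(x)+\rho_Q(y)$ and $\bar\zeta((x,y),(z,w))=\bar\zeta_P(x,z)\cdot\bar\zeta_Q(y,w)$. $B_1=\{\hat0<\hat1\}$ has $\rho(\hat0)=0$, $\rho(\hat1)=1$, $\bar\zeta(\hat0,\hat1)=1$. $G$ is the linear derivation on non-commutative polynomials in $\mathbf a,\mathbf b$ determined by $G(\mathbf a)=\mathbf b\mathbf a$, $G(\mathbf b)=\mathbf a\mathbf b$ (so $G(uv)=G(u)v+uG(v)$), and $\mathrm{Pyr}(w)=w\cdot\mathbf c+G(w)$ with $\mathbf c=\mathbf a+\mathbf b$. *)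

theory Defs
  imports Complex_Main "HOL-Library.Poly_Mapping"
begin

section \<open>Non-commutative polynomials in two variables\<close>

text \<open>
  Polynomials in the non-commuting variables a, b with complex coefficients form the
  monoid algebra of the free monoid of words. Since \<^const>\<open>times\<close> on
  \<^typ>\<open>'w \<Rightarrow>\<^sub>0 'c\<close> is convolution with respect to \<^const>\<open>plus\<close> on \<^typ>\<open>'w\<close>,
  the (non-commutative) monoid of words under concatenation is written additively.
\<close>

datatype ab_letter = Let_a | Let_b

datatype ab_word = Word (letters: "ab_letter list")

instantiation ab_word :: monoid_add
begin

definition zero_ab_word :: ab_word where
  "0 = Word []"

definition plus_ab_word :: "ab_word \<Rightarrow> ab_word \<Rightarrow> ab_word" where
  "u + v = Word (letters u @ letters v)"

instance
  by standard (simp_all add: zero_ab_word_def plus_ab_word_def)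

end

type_synonym ab_poly = "ab_word \<Rightarrow>\<^sub>0 complex"

definition ab_mono :: "ab_letter list \<Rightarrow> ab_poly" where
  "ab_mono w = Poly_Mapping.single (Word w) 1"

definition ab_const :: "complex \<Rightarrow> ab_poly" where
  "ab_const r = Poly_Mapping.single 0 r"

definition var_a :: ab_poly (\<open>\<^bold>a\<close>) where
  "\<^bold>a = ab_mono [Let_a]"

definition var_b :: ab_poly (\<open>\<^bold>b\<close>) where
  "\<^bold>b = ab_mono [Let_b]"

definition var_c :: ab_poly (\<open>\<^bold>c\<close>) where
  "\<^bold>c = \<^bold>a + \<^bold>b"

lemma ab_mono_Nil: "ab_mono [] = 1"
  by (simp add: ab_mono_def flip: zero_ab_word_def)

lemma ab_mono_append: "ab_mono (u @ v) = ab_mono u * ab_mono v"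
  by (simp add: ab_mono_def mult_single plus_ab_word_def)

lemma ab_mono_Cons: "ab_mono (x # v) = ab_mono [x] * ab_mono v"
  using ab_mono_append[of "[x]" v] by simp

lemma ab_const_add: "ab_const (r + s) = ab_const r + ab_const s"
  by (simp add: ab_const_def single_add)

lemma ab_const_mult: "ab_const (r * s) = ab_const r * ab_const s"
  by (simp add: ab_const_def mult_single)

lemma ab_const_0 [simp]: "ab_const 0 = 0"
  by (simp add: ab_const_def)

lemma ab_const_1 [simp]: "ab_const 1 = 1"
  by (simp add: ab_const_def)

lemma ab_const_mult_mono: "ab_const r * ab_mono w = Poly_Mapping.single (Word w) r"
  by (simp add: ab_const_def ab_mono_def mult_single)

lemma ab_mono_mult_const: "ab_mono w * ab_const r = ab_const r * ab_mono w"
  by (simp add: ab_const_def ab_mono_def mult_single)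

lemma ab_poly_induct [case_names zero add_term]:
  assumes "Q 0"
    and "\<And>p r w. Q p \<Longrightarrow> Q (p + ab_const r * ab_mono w)"
  shows "Q (p :: ab_poly)"
proof (induction p rule: Poly_Mapping.update_induct)
  case const
  show ?case by fact
next
  case (update f u r)
  have "Poly_Mapping.update u r f = f + Poly_Mapping.single u r"
    using update.hyps(1)
    by (intro poly_mapping_eqI)
       (auto simp: lookup_update lookup_add lookup_single when_def in_keys_iff)
  also have "\<dots> = f + ab_const r * ab_mono (letters u)"
    by (simp add: ab_const_mult_mono)
  finally show ?case
    using assms(2)[OF update.IH] by simp
qed

lemma ab_const_commute: "p * ab_const r = ab_const r * p"
proof (induction p rule: ab_poly_induct)
  case (add_term p s w)
  have "ab_const s * ab_mono w * ab_const r = ab_const r * (ab_const s * ab_mono w)"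
    by (simp add: ab_const_def ab_mono_def mult_single mult.commute)
  with add_term show ?case
    by (simp add: distrib_left distrib_right)
qed simp

subsection \<open>The derivation G and the pyramid operator\<close>

fun G_letter :: "ab_letter \<Rightarrow> ab_poly" where
  "G_letter Let_a = \<^bold>b * \<^bold>a"
| "G_letter Let_b = \<^bold>a * \<^bold>b"

fun G_word :: "ab_letter list \<Rightarrow> ab_poly" where
  "G_word [] = 0"
| "G_word (x # w) = G_letter x * ab_mono w + ab_mono [x] * G_word w"

text \<open>
  The lemmas \<open>G_is_derivation\<close> and \<open>G_unique\<close> below show that this is the linear derivation
  determined by its values on the two variables.
\<close>
definition G :: "ab_poly \<Rightarrow> ab_poly" where
  "G p = (\<Sum>w\<in>Poly_Mapping.keys p. ab_const (Poly_Mapping.lookup p w) * G_word (letters w))"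

definition Pyr :: "ab_poly \<Rightarrow> ab_poly" where
  "Pyr w = w * \<^bold>c + G w"

definition is_ab_derivation :: "(ab_poly \<Rightarrow> ab_poly) \<Rightarrow> bool" where
  "is_ab_derivation D \<longleftrightarrow>
     (\<forall>u v. D (u + v) = D u + D v) \<and>
     (\<forall>r u. D (ab_const r * u) = ab_const r * D u) \<and>
     (\<forall>u v. D (u * v) = D u * v + u * D v)"

lemma G_0 [simp]: "G 0 = 0"
  by (simp add: G_def)

lemma G_add: "G (p + q) = G p + G q"
  unfolding G_def
  by (rule setsum_keys_plus_distrib) (simp_all add: ab_const_add distrib_right)

lemma G_term: "G (ab_const r * ab_mono w) = ab_const r * G_word w"
  by (simp add: G_def ab_const_mult_mono)

lemma G_mono: "G (ab_mono w) = G_word w"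
  using G_term[of 1 w] by simp

lemma G_scale: "G (ab_const r * p) = ab_const r * G p"
proof (induction p rule: ab_poly_induct)
  case (add_term p s w)
  have "G (ab_const r * (ab_const s * ab_mono w)) = ab_const r * G (ab_const s * ab_mono w)"
    by (simp only: G_term mult.assoc[symmetric] ab_const_mult[symmetric])
  with add_term show ?case
    by (simp add: distrib_left G_add)
qed simp

lemma G_word_append: "G_word (u @ v) = G_word u * ab_mono v + ab_mono u * G_word v"
proof (induction u)
  case Nil
  show ?case by (simp add: ab_mono_Nil)
next
  case (Cons x u)
  show ?case
    by (simp add: Cons ab_mono_append ab_mono_Cons[of x u] algebra_simps)
qed

lemma G_mult: "G (p * q) = G p * q + p * G q"
proof (induction p rule: ab_poly_induct)
  case zero
  show ?case by simp
next
  case (add_term p r u)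
  have mono: "G (ab_mono u * q) = G_word u * q + ab_mono u * G q"
  proof (induction q rule: ab_poly_induct)
    case zero
    show ?case by simp
  next
    case (add_term q s v)
    have "ab_mono u * (ab_const s * ab_mono v) = ab_const s * ab_mono (u @ v)"
      by (simp only: ab_mono_append mult.assoc[symmetric] ab_mono_mult_const)
    then have "G (ab_mono u * (ab_const s * ab_mono v)) = ab_const s * G_word (u @ v)"
      by (simp only: G_term)
    also have "\<dots> = ab_const s * G_word u * ab_mono v + ab_const s * ab_mono u * G_word v"
      by (simp only: G_word_append distrib_left mult.assoc)
    also have "\<dots> = G_word u * (ab_const s * ab_mono v) + ab_mono u * (ab_const s * G_word v)"
      by (simp only: mult.assoc[symmetric] ab_const_commute[of "G_word u"] ab_mono_mult_const)
    finally show ?case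
      using add_term by (simp add: distrib_left G_add G_term)
  qed
  have "G (ab_const r * ab_mono u * q) = ab_const r * G_word u * q + ab_const r * ab_mono u * G q"
    by (simp add: mult.assoc G_scale mono distrib_left)
  with add_term show ?case
    by (simp add: distrib_left distrib_right G_add G_term)
qed

lemma G_is_derivation:
  "is_ab_derivation G" "G \<^bold>a = \<^bold>b * \<^bold>a" "G \<^bold>b = \<^bold>a * \<^bold>b"
proof -
  show "is_ab_derivation G"
    unfolding is_ab_derivation_def by (blast intro: G_add G_scale G_mult)
  show "G \<^bold>a = \<^bold>b * \<^bold>a"
    using G_mono[of "[Let_a]"] by (simp add: ab_mono_Nil flip: var_a_def)
  show "G \<^bold>b = \<^bold>a * \<^bold>b"
    using G_mono[of "[Let_b]"] by (simp add: ab_mono_Nil flip: var_b_def)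
qed

lemma G_unique:
  assumes D: "is_ab_derivation D" "D \<^bold>a = \<^bold>b * \<^bold>a" "D \<^bold>b = \<^bold>a * \<^bold>b"
  shows "D = G"
proof
  fix p
  have add: "D (u + v) = D u + D v" and scale: "D (ab_const r * u) = ab_const r * D u"
    and mult: "D (u * v) = D u * v + u * D v" for u v r
    using D(1) by (auto simp: is_ab_derivation_def)
  have one: "D 1 = 0"
    using mult[of 1 1] by simp
  have letter: "D (ab_mono [x]) = G_letter x" for x
    using D(2,3) by (cases x) (simp_all add: var_a_def var_b_def)
  have word: "D (ab_mono w) = G_word w" for w
  proof (induction w)
    case Nil
    show ?case by (simp add: ab_mono_Nil one)
  next
    case (Cons x w)
    show ?case by (simp add: ab_mono_Cons[of x w] mult letter Cons)
  qed
  show "D p = G p"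
  proof (induction p rule: ab_poly_induct)
    case zero
    show ?case using scale[of 0 0] by simp
  next
    case (add_term p r w)
    then show ?case by (simp add: add scale word G_add G_term)
  qed
qed

section \<open>Quasi-graded posets\<close>

record 'a qgposet =
  elems :: "'a set"
  ord :: "'a rel"
  rank :: "'a \<Rightarrow> nat"
  zeta :: "'a \<Rightarrow> 'a \<Rightarrow> complex"

abbreviation less_in :: "'a qgposet \<Rightarrow> 'a \<Rightarrow> 'a \<Rightarrow> bool" where
  "less_in P x y \<equiv> (x, y) \<in> ord P \<and> x \<noteq> y"

text \<open>
  Elements of the incidence algebra are functions on the intervals of the poset, that is,
  functions of two arguments vanishing outside the order relation.
\<close>
definition incidence_algebra :: "'a rel \<Rightarrow> ('a \<Rightarrow> 'a \<Rightarrow> complex) set" where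
  "incidence_algebra r = {f. \<forall>x y. (x, y) \<notin> r \<longrightarrow> f x y = 0}"

definition quasi_graded :: "'a qgposet \<Rightarrow> bool" where
  "quasi_graded P \<longleftrightarrow>
     finite (elems P) \<and> partial_order_on (elems P) (ord P) \<and>
     (\<forall>x y. less_in P x y \<longrightarrow> rank P x < rank P y) \<and>
     zeta P \<in> incidence_algebra (ord P) \<and>
     (\<forall>x\<in>elems P. zeta P x x = 1)"

definition is_least :: "'a qgposet \<Rightarrow> 'a \<Rightarrow> bool" where
  "is_least P z \<longleftrightarrow> z \<in> elems P \<and> (\<forall>x\<in>elems P. (z, x) \<in> ord P)"

definition is_greatest :: "'a qgposet \<Rightarrow> 'a \<Rightarrow> bool" where
  "is_greatest P t \<longleftrightarrow> t \<in> elems P \<and> (\<forall>x\<in>elems P. (x, t) \<in> ord P)"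

definition interval :: "'a qgposet \<Rightarrow> 'a \<Rightarrow> 'a \<Rightarrow> 'a qgposet" where
  "interval P x y =
     (let S = {z. (x, z) \<in> ord P \<and> (z, y) \<in> ord P} in
      \<lparr>elems = S,
       ord = ord P \<inter> S \<times> S,
       rank = (\<lambda>z. rank P z - rank P x),
       zeta = (\<lambda>u v. if u \<in> S \<and> v \<in> S then zeta P u v else 0)\<rparr>)"

definition qg_prod :: "'a qgposet \<Rightarrow> 'b qgposet \<Rightarrow> ('a \<times> 'b) qgposet" where
  "qg_prod P Q =
     \<lparr>elems = elems P \<times> elems Q,
      ord = {((x, y), (z, w)). (x, z) \<in> ord P \<and> (y, w) \<in> ord Q},
      rank = (\<lambda>(x, y). rank P x + rank Q y),
      zeta = (\<lambda>(x, y) (z, w). zeta P x z * zeta Q y w)\<rparr>"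

text \<open>In \<open>B\<^sub>1\<close>, \<^const>\<open>False\<close> and \<^const>\<open>True\<close> are the minimal and the maximal element.\<close>
definition B1 :: "bool qgposet" where
  "B1 = \<lparr>elems = UNIV,
         ord = {(x, y). x \<le> y},
         rank = of_bool,
         zeta = (\<lambda>x y. of_bool (x \<le> y))\<rparr>"

subsection \<open>The ab-index\<close>

text \<open>
  A chain \<open>x\<^sub>0 < \<dots> < x\<^sub>k\<close> from least to greatest element with \<open>k \<ge> 1\<close> is the list of its
  \<open>k + 1\<close> elements in increasing order.
\<close>
definition full_chains :: "'a qgposet \<Rightarrow> 'a list set" where
  "full_chains P =
     {xs. set xs \<subseteq> elems P \<and> sorted_wrt (less_in P) xs \<and> 2 \<le> length xs \<and>
          is_least P (hd xs) \<and> is_greatest P (last xs)}"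

fun chain_zeta :: "'a qgposet \<Rightarrow> 'a list \<Rightarrow> complex" where
  "chain_zeta P (x # y # xs) = zeta P x y * chain_zeta P (y # xs)"
| "chain_zeta P _ = 1"

text \<open>
  The truncated differences are harmless: along a chain the rank increases strictly. The value
  on lists with fewer than two elements is irrelevant.
\<close>
fun chain_weight :: "'a qgposet \<Rightarrow> 'a list \<Rightarrow> ab_poly" where
  "chain_weight P [x, y] = (\<^bold>a - \<^bold>b) ^ (rank P y - rank P x - 1)"
| "chain_weight P (x # y # z # xs) =
     (\<^bold>a - \<^bold>b) ^ (rank P y - rank P x - 1) * \<^bold>b * chain_weight P (y # z # xs)"
| "chain_weight P _ = 1"

definition ab_index :: "'a qgposet \<Rightarrow> ab_poly" (\<open>\<Psi>\<close>) where
  "\<Psi> P = (\<Sum>xs\<in>full_chains P. ab_const (chain_zeta P xs) * chain_weight P xs)"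

subsection \<open>The constructions stay within quasi-graded posets\<close>

lemma finite_full_chains:
  assumes "quasi_graded P"
  shows "finite (full_chains P)"
proof -
  have "distinct xs" if "sorted_wrt (less_in P) xs" for xs
    using that by (induction xs) auto
  then have "full_chains P \<subseteq> {xs. set xs \<subseteq> elems P \<and> distinct xs}"
    by (auto simp: full_chains_def)
  moreover have "finite {xs. set xs \<subseteq> elems P \<and> distinct xs}"
    using assms by (intro finite_subset_distinct) (simp add: quasi_graded_def)
  ultimately show ?thesis
    by (rule finite_subset)
qed

lemma quasi_graded_interval:
  assumes "quasi_graded P"
  shows "quasi_graded (interval P x y)"
proof -
  define S where "S = {z. (x, z) \<in> ord P \<and> (z, y) \<in> ord P}"
  have po: "ord P \<subseteq> elems P \<times> elems P" "refl_on (elems P) (ord P)" "trans (ord P)" "antisym (ord P)"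
    using assms by (auto simp: quasi_graded_def partial_order_on_def preorder_on_def)
  have S: "S \<subseteq> elems P"
    using po(1) by (auto simp: S_def)
  have "finite S"
    using S assms finite_subset by (auto simp: quasi_graded_def)
  moreover have "partial_order_on S (ord P \<inter> S \<times> S)"
    using po S
    by (auto simp: partial_order_on_def preorder_on_def refl_on_def trans_def antisym_def; blast)
  moreover have "rank P u - rank P x < rank P v - rank P x"
    if "less_in P u v" "u \<in> S" for u v
  proof -
    have "rank P u < rank P v"
      using assms that by (auto simp: quasi_graded_def)
    moreover have "rank P x \<le> rank P u"
      using assms that by (cases "x = u") (auto simp: quasi_graded_def S_def dest: less_imp_le)
    ultimately show ?thesis by simp
  qed
  ultimately show ?thesis
    using assms S
    by (auto simp: quasi_graded_def interval_def incidence_algebra_def Let_def simp flip: S_def)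
qed

lemma quasi_graded_qg_prod:
  assumes "quasi_graded P" "quasi_graded Q"
  shows "quasi_graded (qg_prod P Q)"
proof -
  have *: "rank P x \<le> rank P y" if "(x, y) \<in> ord P" for x y
    using assms(1) that by (cases "x = y") (auto simp: quasi_graded_def dest: less_imp_le)
  have **: "rank Q x \<le> rank Q y" if "(x, y) \<in> ord Q" for x y
    using assms(2) that by (cases "x = y") (auto simp: quasi_graded_def dest: less_imp_le)
  have "partial_order_on (elems P \<times> elems Q) {((x, y), (z, w)). (x, z) \<in> ord P \<and> (y, w) \<in> ord Q}"
    using assms unfolding quasi_graded_def partial_order_on_def preorder_on_def
    by (auto simp: refl_on_def trans_def antisym_def; blast)
  moreover have "rank P x + rank Q y < rank P z + rank Q w"
    if "(x, z) \<in> ord P" "(y, w) \<in> ord Q" "x \<noteq> z \<or> y \<noteq> w" for x y z w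
    using that *[OF that(1)] **[OF that(2)] assms
    by (auto simp: quasi_graded_def intro: add_less_le_mono add_le_less_mono)
  ultimately show ?thesis
    using assms by (auto simp: quasi_graded_def qg_prod_def incidence_algebra_def)
qed

lemma quasi_graded_B1: "quasi_graded B1"
  by (auto simp: quasi_graded_def B1_def incidence_algebra_def partial_order_on_def
      preorder_on_def refl_on_def trans_def antisym_def)

end

theory Submission
  imports Defs
begin

text \<open>
  Sums over chains solve a linear recursion. Write \<open>d = a - b\<close> and let \<open>N\<close> be the strictly
  triangular matrix with entries \<open>\<zeta>(x, y) d\<^bsup>\<rho>(x, y) - 1\<^esup>\<close> for \<open>x < y\<close>. The matrix \<open>\<Psi>\<close> of
  the ab-indices of all intervals is the unique solution of \<open>\<Psi> = N + N b \<Psi>\<close>.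
  For the product with \<open>B\<^sub>1\<close>, the matrix \<open>N\<close> is replaced by the block matrix with rows
  \<open>(N, 1 + N d)\<close> and \<open>(0, N)\<close>, and solving for the upper right block gives
  \<open>(1 + \<Psi> b) (1 + N d) (1 + b \<Psi>) = (1 + \<Psi> a) (1 + b \<Psi>)\<close>, the first formula.
  Since \<open>G(d) = b d - d b\<close>, the derivation \<open>G\<close> acts on \<open>N\<close> as the commutator with \<open>b\<close>; applying
  \<open>G\<close> to the recursion for \<open>\<Psi>\<close> shows that \<open>G(\<Psi>)\<close> and \<open>b \<Psi> - \<Psi> b + \<Psi> a b \<Psi>\<close> solve the same
  recursion, whence the second formula.
\<close>

section \<open>Strictly triangular linear recursions\<close>

text \<open>A nonzero coefficient \<open>n x u\<close> forces \<open>r x < r u\<close>, so downward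
  induction on \<open>r\<close>, starting from its maximum on \<open>S\<close>, determines every
  value.\<close>

lemma triangular_recursion_unique:
  fixes n :: "'a \<Rightarrow> 'a \<Rightarrow> 'r::ring_1" and r :: "'a \<Rightarrow> nat"
  assumes fin: "finite S"
    and tri: "\<And>x u. n x u \<noteq> 0 \<Longrightarrow> r x < r u"
    and f: "\<And>x. x \<in> S \<Longrightarrow> f x = g x + (\<Sum>u\<in>S. n x u * b * f u)"
    and h: "\<And>x. x \<in> S \<Longrightarrow> h x = g x + (\<Sum>u\<in>S. n x u * b * h u)"
    and "x \<in> S"
  shows "f x = h x"
  using \<open>x \<in> S\<close>
proof (induction x rule: measure_induct_rule[of "\<lambda>x. Max (r ` S) - r x"])
  case (less x)
  have "n x u * b * f u = n x u * b * h u" if "u \<in> S" for u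
  proof (cases "n x u = 0")
    case False
    then have "r x < r u" by (rule tri)
    moreover have "r u \<le> Max (r ` S)"
      using fin that by simp
    ultimately show ?thesis
      using less.IH[of u] that by simp
  qed simp
  then show ?case
    using f[of x] h[of x] less.prems by simp
qed

section \<open>Explicit solutions of the two linear recursions\<close>

context
  fixes S :: "'a set" and n p :: "'a \<Rightarrow> 'a \<Rightarrow> 'r::ring_1" and a b :: 'r
  assumes fin: "finite S"
    and p_rec: "\<And>x y. x \<in> S \<Longrightarrow> y \<in> S \<Longrightarrow> p x y = n x y + (\<Sum>u\<in>S. n x u * b * p u y)"
begin

text \<open>Rearranging the recursion to \<open>N b \<Psi> = \<Psi> - N\<close> eliminates
  \<open>N b \<Psi>\<close> in front of any right factor \<open>q\<close>.\<close>

lemma recursion_step: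
  assumes "x \<in> S" "y \<in> S"
  shows "(\<Sum>u\<in>S. n x u * b * (p u y * q)) = p x y * q - n x y * q"
proof -
  have "(\<Sum>u\<in>S. n x u * b * (p u y * q)) = (\<Sum>u\<in>S. n x u * b * p u y) * q"
    by (simp add: sum_distrib_right mult.assoc)
  then show ?thesis
    using p_rec[OF assms] by (simp add: algebra_simps)
qed

lemma recursion_step_sum:
  assumes "x \<in> S"
  shows "(\<Sum>u\<in>S. n x u * b * (\<Sum>v\<in>S. p u v * q v)) = (\<Sum>v\<in>S. p x v * q v) - (\<Sum>v\<in>S. n x v * q v)"
proof -
  have "(\<Sum>u\<in>S. n x u * b * (\<Sum>v\<in>S. p u v * q v)) = (\<Sum>v\<in>S. \<Sum>u\<in>S. n x u * b * (p u v * q v))"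
    unfolding sum_distrib_left by (rule sum.swap)
  also have "\<dots> = (\<Sum>v\<in>S. p x v * q v - n x v * q v)"
    using assms by (intro sum.cong refl recursion_step)
  finally show ?thesis
    by (simp add: sum_subtractf)
qed

text \<open>Here \<open>X\<close> is column \<open>t\<close> of the expanded product
  \<open>(1 + \<Psi> a) (1 + b \<Psi>)\<close> and \<open>m\<close> is \<open>1 + N (a - b)\<close>.
  The terms \<open>N a\<close>, \<open>N b\<close>, \<open>N a b \<Psi>\<close> and
  \<open>N b b \<Psi>\<close> left over from the two sums cancel.\<close>

lemma block_recursion_solution:
  assumes "x \<in> S" "t \<in> S"
  defines "X \<equiv> \<lambda>x. of_bool (x = t) + p x t * a + b * p x t + (\<Sum>u\<in>S. p x u * (a * b * p u t))"
    and "m \<equiv> \<lambda>x y. of_bool (x = y) + n x y * (a - b)"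
  shows "X x = (m x t + (\<Sum>u\<in>S. m x u * b * p u t)) + (\<Sum>u\<in>S. n x u * b * X u)"
proof -
  have "(\<Sum>u\<in>S. n x u * b * of_bool (u = t)) = n x t * b"
    using fin \<open>t \<in> S\<close> by (simp add: of_bool_def if_distrib sum.delta cong: if_cong)
  then have 1: "(\<Sum>u\<in>S. n x u * b * X u) =
      n x t * b + (p x t * a - n x t * a) + (\<Sum>u\<in>S. n x u * b * (b * p u t)) +
      ((\<Sum>v\<in>S. p x v * (a * b * p v t)) - (\<Sum>v\<in>S. n x v * (a * b * p v t)))"
    using recursion_step[OF assms(1,2), of a] recursion_step_sum[OF assms(1), of "\<lambda>v. a * b * p v t"]
    by (simp add: X_def distrib_left sum.distrib)
  have "m x u * b * p u t =
      of_bool (x = u) * (b * p u t) + (n x u * (a * b * p u t) - n x u * b * (b * p u t))" for u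
    by (simp add: m_def algebra_simps)
  moreover have "(\<Sum>u\<in>S. of_bool (x = u) * (b * p u t)) = b * p x t"
    using fin \<open>x \<in> S\<close> by (simp add: of_bool_def if_distrib if_distribR sum.delta' cong: if_cong)
  ultimately have 2: "(\<Sum>u\<in>S. m x u * b * p u t) = b * p x t +
      ((\<Sum>u\<in>S. n x u * (a * b * p u t)) - (\<Sum>u\<in>S. n x u * b * (b * p u t)))"
    by (simp add: sum.distrib sum_subtractf)
  show ?thesis
    unfolding 1 2 by (simp add: X_def m_def algebra_simps)
qed

text \<open>The candidate \<open>Y\<close> for \<open>G(\<Psi>)\<close> is tested without mentioning
  \<open>G\<close>: the commutator \<open>b N - N b\<close> stands for \<open>G(N)\<close>, and
  \<open>a b\<close> for \<open>G(b)\<close>.\<close>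

lemma derivation_recursion_solution:
  assumes "x \<in> S" "t \<in> S"
  defines "Y \<equiv> \<lambda>x. b * p x t - p x t * b + (\<Sum>u\<in>S. p x u * (a * b * p u t))"
  shows "Y x = ((b * n x t - n x t * b) +
      (\<Sum>u\<in>S. (b * n x u - n x u * b) * b * p u t + n x u * (a * b) * p u t)) + (\<Sum>u\<in>S. n x u * b * Y u)"
proof -
  have 1: "(\<Sum>u\<in>S. n x u * b * Y u) =
      (\<Sum>u\<in>S. n x u * b * (b * p u t)) - (p x t * b - n x t * b) +
      ((\<Sum>v\<in>S. p x v * (a * b * p v t)) - (\<Sum>v\<in>S. n x v * (a * b * p v t)))"
    using recursion_step[OF assms(1,2), of b] recursion_step_sum[OF assms(1), of "\<lambda>v. a * b * p v t"]
    by (simp add: Y_def distrib_left right_diff_distrib sum.distrib sum_subtractf)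
  have "(b * n x u - n x u * b) * b * p u t + n x u * (a * b) * p u t =
      b * (n x u * b * p u t) - n x u * b * (b * p u t) + n x u * (a * b * p u t)" for u
    by (simp add: algebra_simps)
  then have 2: "(\<Sum>u\<in>S. (b * n x u - n x u * b) * b * p u t + n x u * (a * b) * p u t) =
      b * (p x t - n x t) - (\<Sum>u\<in>S. n x u * b * (b * p u t)) + (\<Sum>u\<in>S. n x u * (a * b * p u t))"
    using p_rec[OF assms(1,2)] by (simp add: sum.distrib sum_subtractf flip: sum_distrib_left)
  show ?thesis
    unfolding 1 2 by (simp add: Y_def algebra_simps)
qed

end

section \<open>Sums over chains between two elements\<close>

definition chains_between :: "'a qgposet \<Rightarrow> 'a \<Rightarrow> 'a \<Rightarrow> 'a list set" where
  "chains_between P x y =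
     {xs. set xs \<subseteq> elems P \<and> sorted_wrt (less_in P) xs \<and> 2 \<le> length xs \<and> hd xs = x \<and> last xs = y}"

definition chain_term :: "'a qgposet \<Rightarrow> 'a list \<Rightarrow> ab_poly" where
  "chain_term P xs = ab_const (chain_zeta P xs) * chain_weight P xs"

definition chain_sum :: "'a qgposet \<Rightarrow> 'a \<Rightarrow> 'a \<Rightarrow> ab_poly" where
  "chain_sum P x y = (\<Sum>xs\<in>chains_between P x y. chain_term P xs)"

text \<open>The matrix \<open>N\<close>; the value 0 off the strict order lets sums run over all
  elements.\<close>

definition edge :: "'a qgposet \<Rightarrow> 'a \<Rightarrow> 'a \<Rightarrow> ab_poly" where
  "edge P x y = (if less_in P x y
     then ab_const (zeta P x y) * (\<^bold>a - \<^bold>b) ^ (rank P y - rank P x - 1) else 0)"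

lemma quasi_gradedD:
  assumes "quasi_graded P"
  shows "finite (elems P)" "refl_on (elems P) (ord P)" "trans (ord P)" "antisym (ord P)"
    "ord P \<subseteq> elems P \<times> elems P"
    and "less_in P x y \<Longrightarrow> rank P x < rank P y"
    and "x \<in> elems P \<Longrightarrow> zeta P x x = 1"
  using assms by (auto simp: quasi_graded_def partial_order_on_def preorder_on_def)

lemma less_in_trans:
  assumes "quasi_graded P" "less_in P x y" "less_in P y w"
  shows "less_in P x w"
  using assms quasi_gradedD(3,4)[OF assms(1)] by (auto dest: transD antisymD)

lemma finite_chains_between:
  assumes "quasi_graded P"
  shows "finite (chains_between P x y)"
proof -
  have "distinct xs" if "sorted_wrt (less_in P) xs" for xs
    using that by (induction xs) auto
  then have "chains_between P x y \<subseteq> {xs. set xs \<subseteq> elems P \<and> distinct xs}"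
    by (auto simp: chains_between_def)
  then show ?thesis
    using finite_subset_distinct[OF quasi_gradedD(1)[OF assms]] by (rule finite_subset)
qed

lemma sorted_wrt_hd_last:
  assumes "sorted_wrt R xs" "2 \<le> length xs"
  shows "R (hd xs) (last xs)"
  using assms by (cases xs) (auto simp: Suc_le_eq)

lemma chains_between_empty:
  assumes "\<not> less_in P x y"
  shows "chains_between P x y = {}"
  using assms sorted_wrt_hd_last[of "less_in P"] by (auto simp: chains_between_def)

lemma chain_sum_eq_0:
  assumes "\<not> less_in P x y"
  shows "chain_sum P x y = 0"
  using chains_between_empty[OF assms] by (simp add: chain_sum_def)

lemma chains_between_decomp:
  assumes "quasi_graded P" "x \<in> elems P" "y \<in> elems P"
  shows "chains_between P x y = (if less_in P x y then {[x, y]} else {}) \<union>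
           (\<Union>u\<in>{u \<in> elems P. less_in P x u}. (#) x ` chains_between P u y)"
    (is "?L = ?E \<union> ?R")
proof (intro equalityI subsetI)
  fix xs assume "xs \<in> ?L"
  then have xs: "set xs \<subseteq> elems P" "sorted_wrt (less_in P) xs" "2 \<le> length xs" "hd xs = x" "last xs = y"
    by (auto simp: chains_between_def)
  then obtain u ys where ys: "xs = x # u # ys"
    by (cases xs; cases "tl xs") auto
  show "xs \<in> ?E \<union> ?R"
  proof (cases ys)
    case Nil
    with xs ys show ?thesis by simp
  next
    case Cons
    with xs ys have "u # ys \<in> chains_between P u y" "less_in P x u" "u \<in> elems P"
      by (auto simp: chains_between_def)
    with ys show ?thesis by blast
  qed
next
  fix xs assume "xs \<in> ?E \<union> ?R"
  then show "xs \<in> ?L"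
  proof
    assume "xs \<in> ?E"
    with assms show ?thesis
      by (auto simp: chains_between_def split: if_splits)
  next
    assume "xs \<in> ?R"
    then obtain u ys where u: "less_in P x u" and ys: "xs = x # ys" "ys \<in> chains_between P u y"
      by auto
    then obtain vs where vs: "ys = u # vs"
      by (cases ys) (auto simp: chains_between_def)
    \<comment> \<open>\<open>sorted_wrt\<close> compares all pairs, so \<open>x\<close> must lie
      below every element of \<open>ys\<close>, not only below its head \<open>u\<close>.\<close>
    have "less_in P x v" if "v \<in> set ys" for v
      using that u ys less_in_trans[OF assms(1) u] unfolding vs chains_between_def by auto
    with ys assms show ?thesis
      by (auto simp: chains_between_def)
  qed
qed

lemma chain_term_pair: "less_in P x y \<Longrightarrow> chain_term P [x, y] = edge P x y"
  by (simp add: chain_term_def edge_def)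

lemma chain_term_Cons:
  assumes "ys \<in> chains_between P u y" "less_in P x u"
  shows "chain_term P (x # ys) = edge P x u * \<^bold>b * chain_term P ys"
proof -
  obtain v vs where ys: "ys = u # v # vs"
    using assms(1) by (cases ys; cases "tl ys") (auto simp: chains_between_def)
  let ?z = "ab_const (chain_zeta P ys)" and ?w = "(\<^bold>a - \<^bold>b) ^ (rank P u - rank P x - 1)"
  have "chain_term P (x # ys) = ab_const (zeta P x u) * (?z * (?w * \<^bold>b)) * chain_weight P ys"
    by (simp add: ys chain_term_def ab_const_mult mult.assoc)
  \<comment> \<open>Scalars are central, so the zeta values of the tail move past the weight of the
    first step.\<close>
  also have "?z * (?w * \<^bold>b) = ?w * \<^bold>b * ?z"
    by (rule ab_const_commute[symmetric])
  finally show ?thesis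
    using assms(2) by (simp add: edge_def chain_term_def mult.assoc)
qed

text \<open>Chains are sorted by their second element \<open>u\<close>: the one-step chain gives
  \<open>N\<close>, and removing the first step from any other leaves a chain from \<open>u\<close>,
  which gives \<open>N b \<Psi>\<close>.\<close>

lemma chain_sum_rec:
  assumes "quasi_graded P" "x \<in> elems P" "y \<in> elems P"
  shows "chain_sum P x y = edge P x y + (\<Sum>u\<in>elems P. edge P x u * \<^bold>b * chain_sum P u y)"
proof -
  let ?E = "if less_in P x y then {[x, y]} else {}"
  let ?U = "{u \<in> elems P. less_in P x u}"
  let ?R = "\<Union>u\<in>?U. (#) x ` chains_between P u y"
  note fin = quasi_gradedD(1)[OF assms(1)] finite_chains_between[OF assms(1)]
  \<comment> \<open>Lists in \<open>chains_between\<close> have at least two elements, so prepending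
    \<open>x\<close> to one never gives \<open>[x, y]\<close>.\<close>
  have "[] \<notin> chains_between P u y" "[v] \<notin> chains_between P u y" for u v
    by (auto simp: chains_between_def)
  then have "?E \<inter> ?R = {}"
    by auto
  then have "chain_sum P x y = sum (chain_term P) ?E + sum (chain_term P) ?R"
    unfolding chain_sum_def chains_between_decomp[OF assms]
    using fin by (intro sum.union_disjoint) auto
  also have "sum (chain_term P) ?E = edge P x y"
    by (auto simp: chain_term_pair edge_def)
  also have "sum (chain_term P) ?R = (\<Sum>u\<in>?U. sum (chain_term P) ((#) x ` chains_between P u y))"
    using fin by (intro sum.UNION_disjoint) (auto simp: chains_between_def)
  also have "\<dots> = (\<Sum>u\<in>?U. edge P x u * \<^bold>b * chain_sum P u y)"
  proof (rule sum.cong[OF refl])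
    fix u assume "u \<in> ?U"
    then show "sum (chain_term P) ((#) x ` chains_between P u y) = edge P x u * \<^bold>b * chain_sum P u y"
      by (simp add: sum.reindex chain_sum_def sum_distrib_left chain_term_Cons)
  qed
  also have "\<dots> = (\<Sum>u\<in>elems P. edge P x u * \<^bold>b * chain_sum P u y)"
    using fin by (intro sum.mono_neutral_left) (auto simp: edge_def)
  finally show ?thesis .
qed

lemma edge_triangular:
  assumes "quasi_graded P" "edge P x u \<noteq> 0"
  shows "rank P x < rank P u"
  using assms quasi_gradedD(6)[OF assms(1)] by (auto simp: edge_def split: if_splits)

section \<open>The ab-indices of a poset and of its intervals as chain sums\<close>

lemma ab_index_eq_chain_sum:
  assumes "quasi_graded P" "is_least P z" "is_greatest P t"
  shows "\<Psi> P = chain_sum P z t"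
proof -
  have "is_least P x \<longleftrightarrow> x = z" "is_greatest P x \<longleftrightarrow> x = t" for x
    using assms quasi_gradedD(4)[OF assms(1)]
    by (auto simp: is_least_def is_greatest_def dest: antisymD)
  then have "full_chains P = chains_between P z t"
    by (simp add: full_chains_def chains_between_def)
  then show ?thesis
    by (simp add: ab_index_def chain_sum_def chain_term_def)
qed

text \<open>Only rank differences enter. The shift by \<open>rank P x\<close> preserves them, and
  its subtraction is never truncated on elements above \<open>x\<close>.\<close>

lemma chain_term_interval:
  assumes "quasi_graded P" "set xs \<subseteq> elems (interval P x y)"
  shows "chain_term (interval P x y) xs = chain_term P xs"
proof -
  let ?I = "interval P x y"
  have rank: "rank ?I v - rank ?I u = rank P v - rank P u"
    if "u \<in> elems ?I" "v \<in> elems ?I" for u v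
  proof -
    have "rank P x \<le> rank P u"
      using that quasi_gradedD(6)[OF assms(1), of x u]
      by (cases "x = u") (auto simp: interval_def Let_def)
    then show ?thesis by (simp add: interval_def Let_def)
  qed
  have "chain_zeta ?I xs = chain_zeta P xs"
    using assms(2)
    by (induction P xs rule: chain_zeta.induct) (auto simp: interval_def Let_def)
  moreover have "chain_weight ?I xs = chain_weight P xs"
    using assms(2) rank
    by (induction P xs rule: chain_weight.induct) simp_all
  ultimately show ?thesis
    by (simp add: chain_term_def)
qed

lemma ab_index_interval:
  assumes "quasi_graded P" "less_in P x y"
  shows "\<Psi> (interval P x y) = chain_sum P x y"
proof -
  let ?I = "interval P x y"
  note po = quasi_gradedD[OF assms(1)]
  have xy: "(x, x) \<in> ord P" "(y, y) \<in> ord P" "(x, y) \<in> ord P"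
    using po(2,5) assms(2) by (auto dest: refl_onD)
  have "is_least ?I x" "is_greatest ?I y"
    using xy by (auto simp: is_least_def is_greatest_def interval_def Let_def)
  then have "\<Psi> ?I = chain_sum ?I x y"
    by (rule ab_index_eq_chain_sum[OF quasi_graded_interval[OF assms(1)]])
  have elems: "elems ?I = {v. (x, v) \<in> ord P \<and> (v, y) \<in> ord P}"
    by (simp add: interval_def Let_def)
  have sorted: "sorted_wrt (less_in ?I) xs \<longleftrightarrow> sorted_wrt (less_in P) xs" if "set xs \<subseteq> elems ?I" for xs
    using that by (induction xs) (auto simp: interval_def Let_def)
  have "chains_between ?I x y = chains_between P x y"
  proof (intro equalityI subsetI)
    fix xs assume "xs \<in> chains_between ?I x y"
    then show "xs \<in> chains_between P x y"
      using po(5) sorted[of xs] by (auto simp: chains_between_def elems)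
  next
    fix xs assume xs: "xs \<in> chains_between P x y"
    \<comment> \<open>Splitting the chain at \<open>v\<close> shows that \<open>v\<close> is an end
      of it or is comparable with both ends, so the chain stays inside the interval.\<close>
    have "(x, v) \<in> ord P \<and> (v, y) \<in> ord P" if v: "v \<in> set xs" for v
    proof -
      obtain us ws where "xs = us @ v # ws"
        using v by (auto simp: in_set_conv_decomp)
      with xs xy show ?thesis
        by (cases us; cases ws rule: rev_cases) (auto simp: chains_between_def sorted_wrt_append)
    qed
    with xs show "xs \<in> chains_between ?I x y"
      using sorted[of xs] by (auto simp: chains_between_def elems)
  qed
  then have "chain_sum ?I x y = chain_sum P x y"
    unfolding chain_sum_def
    by (intro sum.cong chain_term_interval[OF assms(1)]) (auto simp: chains_between_def)
  with \<open>\<Psi> ?I = chain_sum ?I x y\<close> show ?thesis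
    by simp
qed

section \<open>The product with the two-element chain\<close>

text \<open>These are the blocks of the matrix \<open>N\<close> of the product. Passing from
  \<open>False\<close> to \<open>True\<close> raises the rank by one more, which turns the exponent
  \<open>\<rho> - 1\<close> into \<open>\<rho>\<close>; the vertical step with \<open>x = y\<close>
  has exponent 0 and contributes 1.\<close>

lemma edge_qg_prod_B1:
  assumes "quasi_graded P" "x \<in> elems P"
  shows "edge (qg_prod P B1) (x, e) (y, e) = edge P x y"
    and "edge (qg_prod P B1) (x, True) (y, False) = 0"
    and "edge (qg_prod P B1) (x, False) (y, True) = of_bool (x = y) + edge P x y * (\<^bold>a - \<^bold>b)"
proof -
  show "edge (qg_prod P B1) (x, e) (y, e) = edge P x y"
    by (simp add: edge_def qg_prod_def B1_def)
  show "edge (qg_prod P B1) (x, True) (y, False) = 0"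
    by (simp add: edge_def qg_prod_def B1_def)
  show "edge (qg_prod P B1) (x, False) (y, True) = of_bool (x = y) + edge P x y * (\<^bold>a - \<^bold>b)"
  proof (cases "x = y")
    case True
    then show ?thesis
      using assms quasi_gradedD(2,7)[OF assms(1)]
      by (auto simp: edge_def qg_prod_def B1_def dest: refl_onD)
  next
    case False
    show ?thesis
    proof (cases "(x, y) \<in> ord P")
      case True
      have "rank P x < rank P y"
        using quasi_gradedD(6)[OF assms(1)] True False by simp
      then have "rank P y - rank P x = Suc (rank P y - rank P x - 1)"
        by simp
      then have "(\<^bold>a - \<^bold>b) ^ (rank P y - rank P x) = (\<^bold>a - \<^bold>b) ^ (rank P y - rank P x - 1) * (\<^bold>a - \<^bold>b)"
        by (simp only: flip: power_Suc2)
      with True False show ?thesis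
        by (simp add: edge_def qg_prod_def B1_def mult.assoc)
    qed (use False in \<open>simp add: edge_def qg_prod_def B1_def\<close>)
  qed
qed

lemma sum_qg_prod_B1:
  "(\<Sum>v\<in>elems (qg_prod P B1). f v) = (\<Sum>u\<in>elems P. f (u, False)) + (\<Sum>u\<in>elems P. f (u, True))"
  by (simp add: qg_prod_def B1_def UNIV_bool add.commute sum.cartesian_product' flip: sum.distrib)

text \<open>No edge leaves the \<open>True\<close> layer, and its edges are those of
  \<open>P\<close>, so both sides solve the same recursion.\<close>

lemma chain_sum_qg_prod_B1_True:
  assumes "quasi_graded P" "x \<in> elems P" "y \<in> elems P"
  shows "chain_sum (qg_prod P B1) (x, True) (y, True) = chain_sum P x y"
proof (rule triangular_recursion_unique[where S = "elems P" and n = "edge P" and b = "\<^bold>b"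
      and f = "\<lambda>x. chain_sum (qg_prod P B1) (x, True) (y, True)" and h = "\<lambda>x. chain_sum P x y"
      and g = "\<lambda>x. edge P x y" and r = "rank P"])
  fix x assume x: "x \<in> elems P"
  show "chain_sum (qg_prod P B1) (x, True) (y, True) = edge P x y +
      (\<Sum>u\<in>elems P. edge P x u * \<^bold>b * chain_sum (qg_prod P B1) (u, True) (y, True))"
    using x assms(3)
    by (subst chain_sum_rec[OF quasi_graded_qg_prod[OF assms(1) quasi_graded_B1]])
      (simp_all add: sum_qg_prod_B1 edge_qg_prod_B1[OF assms(1) x], simp_all add: qg_prod_def B1_def)
qed (rule assms quasi_gradedD(1) edge_triangular[OF assms(1)] chain_sum_rec | assumption)+

text \<open>The first step from \<open>(x, False)\<close> either stays in the \<open>False\<close>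
  layer, giving the homogeneous part, or enters the \<open>True\<close> layer, where the rest is a
  chain sum of \<open>P\<close>. Uniqueness then identifies the result with the block
  solution.\<close>

lemma chain_sum_qg_prod_B1:
  assumes P: "quasi_graded P" and "x \<in> elems P" "t \<in> elems P"
  shows "chain_sum (qg_prod P B1) (x, False) (t, True) =
    of_bool (x = t) + chain_sum P x t * \<^bold>a + \<^bold>b * chain_sum P x t +
    (\<Sum>u\<in>elems P. chain_sum P x u * (\<^bold>a * \<^bold>b * chain_sum P u t))"
proof -
  let ?R = "qg_prod P B1" and ?m = "\<lambda>x y. of_bool (x = y) + edge P x y * (\<^bold>a - \<^bold>b)"
  show ?thesis
  proof (rule triangular_recursion_unique[where S = "elems P" and n = "edge P" and b = "\<^bold>b"
        and f = "\<lambda>x. chain_sum ?R (x, False) (t, True)"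
        and h = "\<lambda>x. of_bool (x = t) + chain_sum P x t * \<^bold>a + \<^bold>b * chain_sum P x t +
          (\<Sum>u\<in>elems P. chain_sum P x u * (\<^bold>a * \<^bold>b * chain_sum P u t))"
        and g = "\<lambda>x. ?m x t + (\<Sum>u\<in>elems P. ?m x u * \<^bold>b * chain_sum P u t)" and r = "rank P"])
    fix x assume x: "x \<in> elems P"
    have "chain_sum ?R (x, False) (t, True) = edge ?R (x, False) (t, True) +
        (\<Sum>v\<in>elems ?R. edge ?R (x, False) v * \<^bold>b * chain_sum ?R v (t, True))"
      using x assms(3)
      by (intro chain_sum_rec quasi_graded_qg_prod P quasi_graded_B1) (simp_all add: qg_prod_def B1_def)
    also have "\<dots> = ?m x t + (\<Sum>u\<in>elems P. ?m x u * \<^bold>b * chain_sum P u t) +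
        (\<Sum>u\<in>elems P. edge P x u * \<^bold>b * chain_sum ?R (u, False) (t, True))"
      using assms(3)
      by (simp add: sum_qg_prod_B1 edge_qg_prod_B1[OF P x] chain_sum_qg_prod_B1_True[OF P] add_ac)
    finally show "chain_sum ?R (x, False) (t, True) =
        ?m x t + (\<Sum>u\<in>elems P. ?m x u * \<^bold>b * chain_sum P u t) +
        (\<Sum>u\<in>elems P. edge P x u * \<^bold>b * chain_sum ?R (u, False) (t, True))" .
  qed (rule assms quasi_gradedD(1) edge_triangular[OF P] chain_sum_rec
      block_recursion_solution[where n = "edge P" and p = "chain_sum P" and a = "\<^bold>a" and b = "\<^bold>b"] |
      assumption)+
qed

section \<open>The derivation on sums over chains\<close>

lemma G_sum: "G (\<Sum>i\<in>I. f i) = (\<Sum>i\<in>I. G (f i))"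
  by (induction I rule: infinite_finite_induct) (simp_all add: G_add)

lemma G_diff: "G (p - q) = G p - G q"
  using G_add[of "p - q" q] by simp

text \<open>\<open>G\<close> agrees with the commutator with \<open>b\<close> on
  \<open>a - b\<close>; both are derivations, so they agree on its powers.\<close>

lemma G_power_diff: "G ((\<^bold>a - \<^bold>b) ^ k) = \<^bold>b * (\<^bold>a - \<^bold>b) ^ k - (\<^bold>a - \<^bold>b) ^ k * \<^bold>b"
proof (induction k)
  case 0
  show ?case using G_mult[of 1 1] by simp
next
  case (Suc k)
  have diff: "G (\<^bold>a - \<^bold>b) = \<^bold>b * (\<^bold>a - \<^bold>b) - (\<^bold>a - \<^bold>b) * \<^bold>b"
    by (simp add: G_diff G_is_derivation(2,3) algebra_simps)
  show ?case
    unfolding power_Suc G_mult diff Suc by (simp add: left_diff_distrib right_diff_distrib mult.assoc)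
qed

lemma G_edge: "G (edge P x y) = \<^bold>b * edge P x y - edge P x y * \<^bold>b"
proof -
  have "\<^bold>b * (ab_const r * q) = ab_const r * (\<^bold>b * q)" for r q
    by (simp only: mult.assoc[symmetric] ab_const_commute)
  then show ?thesis
    by (simp add: edge_def G_scale G_power_diff right_diff_distrib mult.assoc)
qed

text \<open>The product rule turns \<open>N b \<Psi>\<close> into
  \<open>G(N) b \<Psi> + N a b \<Psi> + N b G(\<Psi>)\<close>; the last term is the homogeneous part
  of the recursion.\<close>

lemma G_chain_sum:
  assumes P: "quasi_graded P" and "x \<in> elems P" "t \<in> elems P"
  shows "G (chain_sum P x t) = \<^bold>b * chain_sum P x t - chain_sum P x t * \<^bold>b +
    (\<Sum>u\<in>elems P. chain_sum P x u * (\<^bold>a * \<^bold>b * chain_sum P u t))"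
proof (rule triangular_recursion_unique[where S = "elems P" and n = "edge P" and b = "\<^bold>b"
      and f = "\<lambda>x. G (chain_sum P x t)"
      and h = "\<lambda>x. \<^bold>b * chain_sum P x t - chain_sum P x t * \<^bold>b +
        (\<Sum>u\<in>elems P. chain_sum P x u * (\<^bold>a * \<^bold>b * chain_sum P u t))"
      and g = "\<lambda>x. (\<^bold>b * edge P x t - edge P x t * \<^bold>b) +
        (\<Sum>u\<in>elems P. (\<^bold>b * edge P x u - edge P x u * \<^bold>b) * \<^bold>b * chain_sum P u t +
          edge P x u * (\<^bold>a * \<^bold>b) * chain_sum P u t)" and r = "rank P"])
  fix x assume x: "x \<in> elems P"
  show "G (chain_sum P x t) = (\<^bold>b * edge P x t - edge P x t * \<^bold>b) +
        (\<Sum>u\<in>elems P. (\<^bold>b * edge P x u - edge P x u * \<^bold>b) * \<^bold>b * chain_sum P u t +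
          edge P x u * (\<^bold>a * \<^bold>b) * chain_sum P u t) +
        (\<Sum>u\<in>elems P. edge P x u * \<^bold>b * G (chain_sum P u t))"
    by (subst chain_sum_rec[OF P x assms(3)])
      (simp add: G_add G_sum G_mult G_edge G_is_derivation(3) sum.distrib distrib_left distrib_right mult.assoc add.assoc)
qed (rule assms quasi_gradedD(1) edge_triangular[OF P] chain_sum_rec
    derivation_recursion_solution[where n = "edge P" and p = "chain_sum P" and a = "\<^bold>a" and b = "\<^bold>b"] |
    assumption)+

theorem proposition5p2:
  fixes P :: "'a qgposet" and z t :: 'a
  assumes "quasi_graded P"
    and "is_least P z" and "is_greatest P t" and "less_in P z t"
  shows "\<Psi> (qg_prod P B1) =
           \<^bold>b * \<Psi> P + \<Psi> P * \<^bold>a +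
           (\<Sum>x\<in>{x \<in> elems P. less_in P z x \<and> less_in P x t}.
              \<Psi> (interval P z x) * (\<^bold>a * \<^bold>b) * \<Psi> (interval P x t))
         \<and> \<Psi> (qg_prod P B1) = Pyr (\<Psi> P)"
proof -
  let ?C = "chain_sum P"
  have zt: "z \<in> elems P" "t \<in> elems P"
    using assms(2,3) by (auto simp: is_least_def is_greatest_def)
  have \<Psi>: "\<Psi> P = ?C z t"
    by (rule ab_index_eq_chain_sum) (fact assms)+
  have ends: "is_least (qg_prod P B1) (z, False)" "is_greatest (qg_prod P B1) (t, True)"
    using assms(2,3) by (auto simp: is_least_def is_greatest_def qg_prod_def B1_def)
  \<comment> \<open>The term \<open>of_bool (z = t)\<close> vanishes because
    \<open>z < t\<close>.\<close>
  have prod: "\<Psi> (qg_prod P B1) = ?C z t * \<^bold>a + \<^bold>b * ?C z t +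
      (\<Sum>u\<in>elems P. ?C z u * (\<^bold>a * \<^bold>b * ?C u t))"
    using assms(4) ab_index_eq_chain_sum[OF quasi_graded_qg_prod[OF assms(1) quasi_graded_B1] ends]
      chain_sum_qg_prod_B1[OF assms(1) zt] by simp
  have "(\<Sum>x\<in>{x \<in> elems P. less_in P z x \<and> less_in P x t}.
      \<Psi> (interval P z x) * (\<^bold>a * \<^bold>b) * \<Psi> (interval P x t)) =
      (\<Sum>x\<in>{x \<in> elems P. less_in P z x \<and> less_in P x t}. ?C z x * (\<^bold>a * \<^bold>b * ?C x t))"
    by (intro sum.cong refl) (simp add: ab_index_interval[OF assms(1)] mult.assoc)
  \<comment> \<open>Chain sums vanish off the strict order, including at \<open>x = z\<close> and
    \<open>x = t\<close>, so the sum over the open interval extends to all of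
    \<open>elems P\<close>.\<close>
  moreover have "?C z x * (\<^bold>a * \<^bold>b * ?C x t) = 0" if "\<not> (less_in P z x \<and> less_in P x t)" for x
    using that chain_sum_eq_0[of z x P] chain_sum_eq_0[of x t P] by auto
  then have "(\<Sum>x\<in>{x \<in> elems P. less_in P z x \<and> less_in P x t}. ?C z x * (\<^bold>a * \<^bold>b * ?C x t)) =
      (\<Sum>x\<in>elems P. ?C z x * (\<^bold>a * \<^bold>b * ?C x t))"
    using quasi_gradedD(1)[OF assms(1)]
    by (intro sum.mono_neutral_left) auto
  \<comment> \<open>For the second formula, the \<open>- \<Psi> b\<close> in
    \<open>G(\<Psi>)\<close> cancels the \<open>\<Psi> b\<close> in \<open>\<Psi> c\<close>.\<close>
  ultimately show ?thesis
    using prod G_chain_sum[OF assms(1) zt] by (simp add: \<Psi> Pyr_def var_c_def algebra_simps)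
qed

end
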